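(* For every positive integer $k$, let $\lambda_k$ be the (unique) real number $\lambda_k>0$ satisfying $$\Pr[\mathrm{Pois}(\lambda_k)<k]=\frac{\mathbb E[\min\{\mathrm{Pois}(\lambda_k),k\}]}{k}.$$ Then, as $k\to\infty$, $$\Pr[\mathrm{Pois}(\lambda_k)<k]=\frac{\mathbb E[\min\{\mathrm{Pois}(\lambda_k),k\}]}{k}=1-\Theta\big(\sqrt{\log k/k}\big).$$
   Context: $\mathrm{Pois}(\lambda)$ denotes a Poisson random variable with mean $\lambda$. The statement $a_k=1-\Theta(b_k)$ means that there are constants $0<c\le C$ such that $c\,b_k\le 1-a_k\le C\,b_k$ for all sufficiently large $k$. *)

theory Defs
  imports "HOL-Probability.Probability"
begin

definition prob_less :: "nat \<Rightarrow> real \<Rightarrow> real" where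
  "prob_less k l = measure_pmf.prob (poisson_pmf l) {n. n < k}"

definition mean_min :: "nat \<Rightarrow> real \<Rightarrow> real" where
  "mean_min k l = measure_pmf.expectation (poisson_pmf l) (\<lambda>n. real (min n k))"

definition is_balance_rate :: "nat \<Rightarrow> real \<Rightarrow> bool" where
  "is_balance_rate k l \<longleftrightarrow> l > 0 \<and> prob_less k l = mean_min k l / real k"

text \<open>Meaningful only for positive \<open>k\<close>; for \<open>k = 0\<close> the description is not unique
  (both sides of the equation are then \<open>0\<close>).\<close>
definition balance_rate :: "nat \<Rightarrow> real" where
  "balance_rate k = (THE l. is_balance_rate k l)"

definition one_minus_Theta :: "(nat \<Rightarrow> real) \<Rightarrow> (nat \<Rightarrow> real) \<Rightarrow> bool" where
  "one_minus_Theta a b \<longleftrightarrow>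
     (\<exists>c C. 0 < c \<and> c \<le> C \<and>
        (\<forall>\<^sub>F k in sequentially. c * b k \<le> 1 - a k \<and> 1 - a k \<le> C * b k))"

end

theory Submission
  imports Defs "HOL-Real_Asymp.Real_Asymp"
begin

text \<open>
  Write \<open>X\<close> for \<open>Pois(l)\<close>, \<open>F(l) = P(X < k)\<close> and \<open>D(l) = E[max(k - X, 0)]\<close>.  The balance equation reads
  \<open>F(l) + D(l) / k = 1\<close>, and its left-hand side decreases strictly from \<open>2\<close> to \<open>0\<close>.  At the solution
  the quantity of interest is \<open>1 - F = D / k\<close>, and \<open>D\<close> is decreasing, so it suffices to compare
  the solution with two explicit rates \<open>k - c sqrt(k ln k)\<close>.  For \<open>c = 1\<close> a Chernoff bound gives
  \<open>P(X \<ge> k) \<le> 1 / sqrt k\<close>, which is smaller than \<open>D / k\<close>, so the solution lies to the right.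
  For \<open>c = 1/4\<close> the terms \<open>P(X = k + j)\<close> with \<open>1 \<le> j \<le> k powr (1/4)\<close> already add up to
  more than \<open>D / k - P(X = k)\<close>, so the solution lies to the left.
\<close>

section \<open>Poisson weights, distribution function and shortfall\<close>

text \<open>Given by formula rather than as \<open>pmf (poisson_pmf l)\<close>, so that it makes
  sense and can be differentiated at every real \<open>l\<close>, including the endpoint 0 of the
  intermediate value argument.\<close>

definition pois_mass :: "nat \<Rightarrow> real \<Rightarrow> real" where
  "pois_mass n l = l ^ n / fact n * exp (- l)"

definition pois_cdf :: "nat \<Rightarrow> real \<Rightarrow> real" where
  "pois_cdf k l = (\<Sum>n<k. pois_mass n l)"

definition shortfall :: "nat \<Rightarrow> real \<Rightarrow> real" where
  "shortfall k l = (\<Sum>n<k. (real k - real n) * pois_mass n l)"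

lemma pois_mass_pos: "0 < l \<Longrightarrow> 0 < pois_mass n l"
  by (simp add: pois_mass_def)

lemma pois_mass_nonneg: "0 \<le> l \<Longrightarrow> 0 \<le> pois_mass n l"
  by (simp add: pois_mass_def)

lemma pois_mass_0: "pois_mass n 0 = (if n = 0 then 1 else 0)"
  by (simp add: pois_mass_def)

lemma pois_mass_Suc: "real (Suc n) * pois_mass (Suc n) l = l * pois_mass n l"
  by (simp add: pois_mass_def field_simps del: of_nat_Suc)

lemma pois_mass_sums: "(\<lambda>n. pois_mass n l) sums 1"
proof -
  have "(\<lambda>n. l ^ n /\<^sub>R fact n * exp (- l)) sums (exp l * exp (- l))"
    by (intro sums_mult2 exp_converges)
  thus ?thesis by (simp add: pois_mass_def[abs_def] exp_minus divide_inverse mult.commute)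
qed

lemma pois_cdf_0: "k \<ge> 1 \<Longrightarrow> pois_cdf k 0 = 1"
  by (simp add: pois_cdf_def pois_mass_0)

lemma shortfall_0: "shortfall k 0 = real k"
  by (cases k) (simp_all add: shortfall_def pois_mass_0 sum.lessThan_Suc_shift del: sum.lessThan_Suc)

lemma pois_cdf_le_1: "0 \<le> l \<Longrightarrow> pois_cdf k l \<le> 1"
  unfolding pois_cdf_def
  using sum_le_suminf[of "\<lambda>n. pois_mass n l" "{..<k}"] pois_mass_sums[of l]
  by (auto simp: sums_iff pois_mass_nonneg)

lemma pois_cdf_nonneg: "0 \<le> l \<Longrightarrow> 0 \<le> pois_cdf k l"
  unfolding pois_cdf_def by (intro sum_nonneg) (auto simp: pois_mass_nonneg)

section \<open>Derivatives with respect to the rate\<close>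

lemma DERIV_pois_mass_0: "(pois_mass 0 has_real_derivative - pois_mass 0 l) (at l)"
  unfolding pois_mass_def[abs_def] by (auto intro!: derivative_eq_intros)

lemma DERIV_pois_mass_Suc:
  "(pois_mass (Suc n) has_real_derivative pois_mass n l - pois_mass (Suc n) l) (at l)"
proof -
  have "((\<lambda>l. l ^ Suc n / fact (Suc n) * exp (- l)) has_real_derivative
          real (Suc n) * l ^ n / fact (Suc n) * exp (- l) - l ^ Suc n / fact (Suc n) * exp (- l)) (at l)"
    by (auto intro!: derivative_eq_intros simp: diff_divide_distrib mult_ac
        simp del: fact_Suc of_nat_Suc power_Suc)
  moreover have "real (Suc n) * l ^ n / fact (Suc n) = l ^ n / fact n"
    by (simp add: field_simps del: of_nat_Suc)
  ultimately show ?thesis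
    unfolding pois_mass_def[abs_def] by simp
qed

lemma pois_cdf_Suc: "pois_cdf (Suc k) = (\<lambda>l. pois_cdf k l + pois_mass k l)"
  by (simp add: pois_cdf_def fun_eq_iff)

text \<open>The weights satisfy p_n' = p_(n-1) - p_n, so the derivative of the partial sum
  telescopes to its last term.\<close>

lemma DERIV_pois_cdf: "(pois_cdf (Suc k) has_real_derivative - pois_mass k l) (at l)"
proof (induction k)
  case 0
  show ?case using DERIV_pois_mass_0[of l] by (simp add: pois_cdf_def[abs_def])
next
  case (Suc k)
  show ?case unfolding pois_cdf_Suc[of "Suc k"]
    by (rule DERIV_cong[OF DERIV_add[OF Suc DERIV_pois_mass_Suc]]) simp
qed

text \<open>Raising the threshold by one adds 1 to every gap up to \<open>k\<close>. This recursion
  carries differentiation over from the distribution function to the shortfall.\<close>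

lemma shortfall_Suc: "shortfall (Suc k) = (\<lambda>l. shortfall k l + pois_cdf (Suc k) l)"
  by (simp add: shortfall_def pois_cdf_def fun_eq_iff sum.distrib algebra_simps sum_subtractf)

lemma DERIV_shortfall: "(shortfall k has_real_derivative - pois_cdf k l) (at l)"
proof (induction k)
  case 0
  show ?case by (simp add: shortfall_def[abs_def] pois_cdf_def)
next
  case (Suc k)
  show ?case unfolding shortfall_Suc
    by (rule DERIV_cong[OF DERIV_add[OF Suc DERIV_pois_cdf]]) (simp add: pois_cdf_def)
qed

lemma shortfall_antimono: "0 \<le> a \<Longrightarrow> a \<le> b \<Longrightarrow> shortfall k b \<le> shortfall k a"
  by (rule DERIV_nonpos_imp_nonincreasing)
     (auto intro!: exI[of _ "- pois_cdf k _"] DERIV_shortfall pois_cdf_nonneg)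

text \<open>Jensen's inequality for max(k - X, 0), obtained here from monotonicity:
  \<open>shortfall k l + l\<close> starts at \<open>k\<close> and has derivative 1 - F \<ge>
  0.\<close>

lemma shortfall_ge:
  assumes "0 \<le> l"
  shows "real k - l \<le> shortfall k l"
proof -
  have "shortfall k 0 + 0 \<le> shortfall k l + l"
  proof (rule DERIV_nonneg_imp_nondecreasing[OF assms])
    fix x :: real assume "0 \<le> x"
    thus "\<exists>y. ((\<lambda>x. shortfall k x + x) has_real_derivative y) (at x) \<and> 0 \<le> y"
      using DERIV_add[OF DERIV_shortfall DERIV_ident] pois_cdf_le_1[of x k] by fastforce
  qed
  thus ?thesis by (simp add: shortfall_0)
qed

text \<open>Rests on n p_n = l p_(n-1). It splits D into a main term governed by the gap
  \<open>k - l\<close> and a multiple of one single weight.\<close>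

lemma shortfall_eq: "shortfall k l = (real k - l) * pois_cdf k l + real k * pois_mass k l"
proof (induction k)
  case 0
  show ?case by (simp add: shortfall_def pois_cdf_def)
next
  case (Suc k)
  show ?case using Suc pois_mass_Suc[of k l]
    by (simp add: shortfall_Suc pois_cdf_Suc algebra_simps)
qed

lemma shortfall_le:
  assumes "0 \<le> l"
  shows "shortfall k l \<le> real k * pois_cdf k l"
  unfolding shortfall_def pois_cdf_def sum_distrib_left
  by (intro sum_mono mult_right_mono) (auto simp: pois_mass_nonneg assms)

section \<open>Poisson probabilities and expectations as finite sums\<close>

lemma prob_less_eq:
  assumes "0 < l"
  shows "prob_less k l = pois_cdf k l"
proof -
  have "{n. n < k} = {..<k}" by auto
  thus ?thesis using assms
    by (simp add: prob_less_def pois_cdf_def pois_mass_def measure_measure_pmf_finite)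
qed

lemma mean_min_eq:
  assumes "0 < l"
  shows "mean_min k l = real k - shortfall k l"
proof -
  let ?M = "measure_pmf (poisson_pmf l)"
  have int: "integrable ?M (\<lambda>n. real (min n k))"
    by (rule measure_pmf.integrable_const_bound[where B = "real k"]) auto
  have "real k - mean_min k l = (\<integral>n. real k - real (min n k) \<partial>?M)"
    unfolding mean_min_def by (subst Bochner_Integration.integral_diff) (use int in auto)
  \<comment> \<open>The integrand vanishes for \<open>n \<ge> k\<close>, so only finitely many terms
    remain.\<close>
  also have "\<dots> = (\<Sum>n<k. (real k - real (min n k)) * pmf (poisson_pmf l) n)"
    by (rule integral_measure_pmf_real) (auto simp: min_def split: if_splits)
  also have "\<dots> = shortfall k l"
    unfolding shortfall_def using assms by (intro sum.cong) (auto simp: pois_mass_def)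
  finally show ?thesis by simp
qed

section \<open>The balance equation\<close>

definition balance_fun :: "nat \<Rightarrow> real \<Rightarrow> real" where
  "balance_fun k l = pois_cdf k l + shortfall k l / real k"

lemma is_balance_rate_iff:
  assumes "k \<ge> 1"
  shows "is_balance_rate k l \<longleftrightarrow> 0 < l \<and> balance_fun k l = 1"
  using assms
  by (auto simp: is_balance_rate_def prob_less_eq mean_min_eq balance_fun_def field_simps)

lemma DERIV_balance_fun:
  assumes "k \<ge> 1"
  shows "(balance_fun k has_real_derivative
           - pois_mass (k - 1) l - pois_cdf k l / real k) (at l)"
proof -
  have "Suc (k - 1) = k" using assms by simp
  hence "(pois_cdf k has_real_derivative - pois_mass (k - 1) l) (at l)"
    using DERIV_pois_cdf[of "k - 1" l] by simp
  thus ?thesis using assms unfolding balance_fun_def[abs_def]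
    by (auto intro!: derivative_eq_intros DERIV_shortfall)
qed

lemma isCont_balance_fun: "k \<ge> 1 \<Longrightarrow> isCont (balance_fun k) l"
  using DERIV_balance_fun DERIV_isCont by blast

lemma balance_fun_strict_antimono:
  assumes "k \<ge> 1" "0 < a" "a < b"
  shows "balance_fun k b < balance_fun k a"
proof (rule DERIV_neg_imp_decreasing[OF assms(3)])
  fix x assume "a \<le> x" "x \<le> b"
  hence "0 < x" using assms by simp
  hence "- pois_mass (k - 1) x - pois_cdf k x / real k < 0"
    using pois_mass_pos[of x "k - 1"] pois_cdf_nonneg[of x k]
    by (smt (verit) divide_nonneg_nonneg of_nat_0_le_iff)
  thus "\<exists>y. (balance_fun k has_real_derivative y) (at x) \<and> y < 0"
    using DERIV_balance_fun[OF assms(1)] by blast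
qed

lemma pois_cdf_tendsto_0: "(pois_cdf k \<longlongrightarrow> 0) at_top"
proof -
  have "((\<lambda>l. pois_mass n l) \<longlongrightarrow> 0) at_top" for n
  proof -
    have "((\<lambda>l::real. l ^ n / exp l / fact n) \<longlongrightarrow> 0 / fact n) at_top"
      by (intro tendsto_divide tendsto_power_div_exp_0 tendsto_const) auto
    thus ?thesis by (simp add: pois_mass_def[abs_def] exp_minus field_simps)
  qed
  hence "((\<lambda>l. \<Sum>n<k. pois_mass n l) \<longlongrightarrow> (\<Sum>n<k. 0)) at_top"
    by (intro tendsto_sum)
  thus ?thesis by (simp add: pois_cdf_def[abs_def])
qed

lemma ex1_is_balance_rate:
  assumes k: "k \<ge> 1"
  shows "\<exists>!l. is_balance_rate k l"
proof -
  have "eventually (\<lambda>l. pois_cdf k l < 1/2) at_top"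
    using order_tendstoD(2)[OF pois_cdf_tendsto_0, of "1/2"] by simp
  with eventually_gt_at_top[of 0]
  have "eventually (\<lambda>l. 0 < l \<and> pois_cdf k l < 1/2) at_top" by (rule eventually_conj)
  then obtain b where b: "0 < b" "pois_cdf k b < 1/2"
    by (auto simp: eventually_at_top_linorder)
  \<comment> \<open>Hence \<open>balance_fun k b\<close> is at most twice
    \<open>pois_cdf k b\<close>, which is why \<open>b\<close> was chosen with the bound
    1/2.\<close>
  have "shortfall k b / real k \<le> pois_cdf k b"
    using shortfall_le[of b k] b k by (simp add: field_simps)
  hence fb: "balance_fun k b \<le> 1" using b by (simp add: balance_fun_def)
  have f0: "balance_fun k 0 = 2"
    using k by (simp add: balance_fun_def pois_cdf_0 shortfall_0)
  have "\<exists>x. 0 \<le> x \<and> x \<le> b \<and> balance_fun k x = 1"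
    using fb f0 b k
    by (intro IVT2') (auto intro!: continuous_at_imp_continuous_on isCont_balance_fun)
  then obtain x where x: "0 \<le> x" "balance_fun k x = 1" by auto
  hence "0 < x" using f0 by (cases "x = 0") auto
  show ?thesis
  proof (rule ex1I)
    show "is_balance_rate k x" using x \<open>0 < x\<close> is_balance_rate_iff[OF k] by simp
    fix y assume "is_balance_rate k y"
    hence "0 < y" "balance_fun k y = 1" using is_balance_rate_iff[OF k] by auto
    thus "y = x"
      using balance_fun_strict_antimono[OF k, of x y] balance_fun_strict_antimono[OF k, of y x]
        x \<open>0 < x\<close> by (cases x y rule: linorder_cases) auto
  qed
qed

lemma is_balance_rate_balance_rate: "k \<ge> 1 \<Longrightarrow> is_balance_rate k (balance_rate k)"
  unfolding balance_rate_def by (rule theI'[OF ex1_is_balance_rate])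

section \<open>Bounds at the solution from trial rates\<close>

lemma one_minus_prob_less_balance_rate:
  assumes "k \<ge> 1"
  shows "1 - prob_less k (balance_rate k) = shortfall k (balance_rate k) / real k"
  using is_balance_rate_balance_rate[OF assms] is_balance_rate_iff[OF assms]
  by (auto simp: prob_less_eq balance_fun_def)

text \<open>By strict monotonicity the trial rate \<open>l\<close> does not exceed the solution, and
  the shortfall decreases in the rate; so a bound results without solving the equation.\<close>

lemma one_minus_prob_less_le:
  assumes k: "k \<ge> 1" and l: "0 < l" and "1 \<le> balance_fun k l"
  shows "1 - prob_less k (balance_rate k) \<le> shortfall k l / real k"
proof -
  have "0 < balance_rate k" "balance_fun k (balance_rate k) = 1"
    using is_balance_rate_balance_rate[OF k] is_balance_rate_iff[OF k] by auto
  hence "l \<le> balance_rate k"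
    using balance_fun_strict_antimono[OF k, of "balance_rate k" l] assms by force
  thus ?thesis
    using shortfall_antimono[of l "balance_rate k" k] l
    by (simp add: one_minus_prob_less_balance_rate[OF k] divide_right_mono)
qed

text \<open>Mirror image: the solution does not exceed the trial rate.\<close>

lemma one_minus_prob_less_ge:
  assumes k: "k \<ge> 1" and l: "0 < l" and "balance_fun k l \<le> 1"
  shows "shortfall k l / real k \<le> 1 - prob_less k (balance_rate k)"
proof -
  have pos: "0 < balance_rate k" and "balance_fun k (balance_rate k) = 1"
    using is_balance_rate_balance_rate[OF k] is_balance_rate_iff[OF k] by auto
  hence "balance_rate k \<le> l"
    using balance_fun_strict_antimono[OF k, of l "balance_rate k"] assms by force
  thus ?thesis
    using shortfall_antimono[of "balance_rate k" l k] pos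
    by (simp add: one_minus_prob_less_balance_rate[OF k] divide_right_mono)
qed

section \<open>Tail bounds\<close>

lemma ln_one_minus_le:
  fixes x :: real
  assumes "0 \<le> x" "x < 1"
  shows "ln (1 - x) \<le> - x - x\<^sup>2 / 2"
proof -
  have "(\<lambda>t. - t - t\<^sup>2 / 2 - ln (1 - t)) 0 \<le> (\<lambda>t. - t - t\<^sup>2 / 2 - ln (1 - t)) x"
  proof (rule DERIV_nonneg_imp_nondecreasing[OF assms(1)])
    fix t assume "0 \<le> t" "t \<le> x"
    hence t: "t < 1" using assms by simp
    hence "((\<lambda>t. - t - t\<^sup>2 / 2 - ln (1 - t)) has_real_derivative - 1 - t + 1 / (1 - t)) (at t)"
      by (auto intro!: derivative_eq_intros)
    moreover have "- 1 - t + 1 / (1 - t) = t\<^sup>2 / (1 - t)"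
      using t by (simp add: field_simps power2_eq_square)
    ultimately show "\<exists>y. ((\<lambda>t. - t - t\<^sup>2 / 2 - ln (1 - t)) has_real_derivative y) (at t) \<and> 0 \<le> y"
      using t by auto
  qed
  thus ?thesis by simp
qed

lemma pois_mass_change_rate:
  assumes "0 < m"
  shows "pois_mass n l = exp (m - l) * (l / m) ^ n * pois_mass n m"
  using assms by (simp add: pois_mass_def power_divide exp_diff exp_minus field_simps)

text \<open>Puts the change-of-rate factor at \<open>n = k\<close> in terms of the relative gap x =
  (k - l) / k, so that upper and lower bounds for ln (1 - x) estimate it.\<close>

lemma exp_mult_power_eq:
  assumes "k \<ge> 1" "0 < l"
  shows "exp (real k - l) * (l / real k) ^ k
       = exp (real k * ((real k - l) / real k + ln (1 - (real k - l) / real k)))"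
proof -
  have "1 - (real k - l) / real k = l / real k" using assms by (simp add: field_simps)
  moreover have "(l / real k) ^ k = exp (real k * ln (l / real k))"
    using assms by (simp add: exp_of_nat_mult)
  ultimately show ?thesis using assms by (simp add: exp_add [symmetric] distrib_left)
qed

text \<open>Changing the rate from \<open>k\<close> to \<open>l \<le> k\<close> multiplies the weight of \<open>n \<ge> k\<close> by
  \<open>exp (k - l) * (l / k) ^ n\<close>, which is largest at \<open>n = k\<close>.\<close>

lemma pois_tail_le:
  assumes k: "k \<ge> 1" and l: "0 < l" "l \<le> real k"
  shows "1 - pois_cdf k l \<le> exp (- ((real k - l)\<^sup>2 / (2 * real k)))"
proof -
  let ?c = "exp (real k - l) * (l / real k) ^ k"
  have tail: "(\<lambda>n. pois_mass (n + k) m) sums (1 - pois_cdf k m)" for m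
    unfolding pois_cdf_def
    by (rule iffD2[OF sums_iff_shift]) (use pois_mass_sums[of m] in simp)
  have "pois_mass (n + k) l \<le> ?c * pois_mass (n + k) (real k)" for n
  proof -
    have "(l / real k) ^ (n + k) \<le> (l / real k) ^ k"
      using l k by (intro power_decreasing) auto
    thus ?thesis using k
      by (subst pois_mass_change_rate[of "real k"])
         (auto intro!: mult_right_mono mult_left_mono pois_mass_nonneg)
  qed
  hence "1 - pois_cdf k l \<le> ?c * (1 - pois_cdf k (real k))"
    by (rule sums_le[OF _ tail sums_mult[OF tail]])
  \<comment> \<open>The tail at rate \<open>k\<close> is at most 1; dropping it leaves the Chernoff
    factor.\<close>
  also have "\<dots> \<le> ?c * 1"
    using l by (intro mult_left_mono) (auto simp: pois_cdf_nonneg)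
  also have "?c * 1 \<le> exp (- ((real k - l)\<^sup>2 / (2 * real k)))"
  proof -
    define x where "x = (real k - l) / real k"
    have "ln (1 - x) \<le> - x - x\<^sup>2 / 2"
      using k l by (intro ln_one_minus_le) (auto simp: x_def field_simps)
    hence "real k * (x + ln (1 - x)) \<le> real k * - (x\<^sup>2 / 2)"
      by (intro mult_left_mono) auto
    also have "\<dots> = - ((real k - l)\<^sup>2 / (2 * real k))"
      using k by (simp add: x_def field_simps power2_eq_square)
    finally show ?thesis using exp_mult_power_eq[OF k l(1)] by (simp add: x_def)
  qed
  finally show ?thesis .
qed

lemma pois_mass_le_tail: "0 \<le> l \<Longrightarrow> pois_mass k l \<le> 1 - pois_cdf k l"
  using pois_cdf_le_1[of l "Suc k"] by (simp add: pois_cdf_Suc)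

section \<open>Lower bounds for weights and tail\<close>

lemma fact_le_Stirling:
  assumes "k \<ge> 1"
  shows "fact k \<le> exp 1 * sqrt (real k) * (real k ^ k * exp (- real k))"
  using assms
proof (induction k rule: dec_induct)
  case base
  show ?case by (simp flip: exp_add)
next
  case (step k)
  have k: "real k > 0" using step by simp
  \<comment> \<open>The midpoint bound ln (1 + 1/k) \<ge> 1 / (k + 1/2) is exactly what the
    induction step needs with the factor sqrt k; the constant e makes the case k = 1 an
    equality.\<close>
  have "1 \<le> (real k + 1/2) * (ln (real k + 1) - ln (real k))"
    using ln_inverse_approx_ge[of "real k" "real k + 1"] k by (simp add: field_simps)
  hence "1 + ln (real k) / 2 + real k * ln (real k) + ln (real k + 1) \<le>
         ln (real k + 1) / 2 + real (Suc k) * ln (real k + 1)"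
    by (simp add: algebra_simps)
  hence "exp (1 + ln (real k) / 2 + real k * ln (real k) + ln (real k + 1)) \<le>
         exp (ln (real k + 1) / 2 + real (Suc k) * ln (real k + 1))" by simp
  moreover have sq: "exp (ln x / 2) = sqrt x" if "x > 0" for x :: real
    using that by (simp add: ln_sqrt[symmetric])
  ultimately have *: "exp 1 * sqrt (real k) * real k ^ k * (real k + 1) \<le>
        sqrt (real k + 1) * (real k + 1) ^ Suc k"
    using k by (simp only: exp_add exp_of_nat_mult exp_ln sq)
  have "fact (Suc k) = (real k + 1) * fact k" by simp
  also have "\<dots> \<le> (real k + 1) * (exp 1 * sqrt (real k) * (real k ^ k * exp (- real k)))"
    using step by (intro mult_left_mono) auto
  also have "\<dots> = (exp 1 * sqrt (real k) * real k ^ k * (real k + 1)) * exp (- real k)"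
    by (simp add: algebra_simps)
  also have "\<dots> \<le> (sqrt (real k + 1) * (real k + 1) ^ Suc k) * exp (- real k)"
    using * by (intro mult_right_mono) auto
  also have "exp (- real k) = exp 1 * exp (- real (Suc k))"
    by (simp flip: exp_add)
  finally show ?case by (simp add: algebra_simps)
qed

text \<open>At rate \<open>k\<close> the weight is at least 1 / (e sqrt k) by the factorial bound,
  and ln (1 - x) \<ge> - x - 2 x^2 controls the change of rate. The latter is applied with x \<le>
  1/2, that is \<open>l \<ge> k / 2\<close>.\<close>

lemma pois_mass_ge:
  assumes k: "k \<ge> 1" and l: "real k / 2 \<le> l" "l \<le> real k"
  shows "exp (- (2 * (real k - l)\<^sup>2 / real k)) / (exp 1 * sqrt (real k)) \<le> pois_mass k l"
proof -
  have l0: "0 < l" using k l by linarith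
  define x where "x = (real k - l) / real k"
  have "- x - 2 * x\<^sup>2 \<le> ln (1 - x)"
    using k l by (intro ln_one_minus_pos_lower_bound) (auto simp: x_def field_simps)
  hence "real k * - (2 * x\<^sup>2) \<le> real k * (x + ln (1 - x))"
    by (intro mult_left_mono) auto
  moreover have "real k * - (2 * x\<^sup>2) = - (2 * (real k - l)\<^sup>2 / real k)"
    using k by (simp add: x_def field_simps power2_eq_square)
  ultimately have a: "exp (- (2 * (real k - l)\<^sup>2 / real k)) \<le> exp (real k - l) * (l / real k) ^ k"
    unfolding exp_mult_power_eq[OF k l0] x_def by simp
  have b: "1 / (exp 1 * sqrt (real k)) \<le> pois_mass k (real k)"
    using fact_le_Stirling[OF k] k by (simp add: pois_mass_def field_simps)
  have "exp (- (2 * (real k - l)\<^sup>2 / real k)) * (1 / (exp 1 * sqrt (real k))) \<le>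
        exp (real k - l) * (l / real k) ^ k * pois_mass k (real k)"
    using a b l0 by (intro mult_mono) auto
  thus ?thesis using k by (subst pois_mass_change_rate[of "real k"]) auto
qed

text \<open>Up to \<open>k + J\<close> the ratio of consecutive weights is at least
  \<open>r\<close>, and Bernoulli's inequality gives r^J \<ge> 1 - J (1 - r) \<ge> 1/2, the last by
  the assumed bound on \<open>J\<close>.\<close>

lemma pois_mass_add_ge:
  assumes k: "k \<ge> 1" and l: "0 < l" "l \<le> real k" and "j \<le> J"
    and J: "2 * real J * (real k - l + real J) \<le> real k"
  shows "pois_mass k l / 2 \<le> pois_mass (k + j) l"
proof -
  \<comment> \<open>The smallest of the ratios l / (k + i) with i \<le> J.\<close>
  define r where "r = l / (real k + real J)"
  have r: "0 < r" "r \<le> 1" using l k by (auto simp: r_def)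
  have step: "pois_mass k l * r ^ j \<le> pois_mass (k + j) l" if "j \<le> J" for j
    using that
  proof (induction j)
    case (Suc j)
    have "r \<le> l / real (Suc (k + j))"
      unfolding r_def using Suc.prems l k by (intro divide_left_mono) auto
    moreover have "pois_mass k l * r ^ j \<le> pois_mass (k + j) l" using Suc by simp
    ultimately have "pois_mass k l * r ^ j * r \<le> pois_mass (k + j) l * (l / real (Suc (k + j)))"
      using r l by (intro mult_mono) (auto simp: pois_mass_nonneg)
    also have "\<dots> = pois_mass (k + Suc j) l"
      using pois_mass_Suc[of "k + j" l] by (simp add: field_simps del: of_nat_Suc)
    finally show ?case by (simp add: mult_ac)
  qed simp
  have "1 - r = (real k - l + real J) / (real k + real J)"
    using k by (simp add: r_def field_simps)
  also have "\<dots> \<le> (real k - l + real J) / real k"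
    using k l by (intro divide_left_mono) auto
  finally have "real J * (1 - r) \<le> real J * ((real k - l + real J) / real k)"
    by (intro mult_left_mono) auto
  also have "\<dots> \<le> 1 / 2" using J k by (simp add: field_simps)
  finally have "1 / 2 \<le> 1 + real J * (r - 1)" by (simp add: algebra_simps)
  also have "\<dots> \<le> r ^ J" using Bernoulli_inequality[of "r - 1" J] r by simp
  also have "\<dots> \<le> r ^ j" using r assms by (intro power_decreasing) auto
  finally have "pois_mass k l * (1 / 2) \<le> pois_mass k l * r ^ j"
    using l by (intro mult_left_mono) (auto simp: pois_mass_nonneg)
  thus ?thesis using step[OF \<open>j \<le> J\<close>] by simp
qed

text \<open>The weight at \<open>k\<close> is counted in full, to match the same weight in
  \<open>shortfall k l / k\<close>; each of the next \<open>J\<close> weights contributes at least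
  half of it.\<close>

lemma pois_tail_ge:
  assumes k: "k \<ge> 1" and l: "0 < l" "l \<le> real k"
    and J: "2 * real J * (real k - l + real J) \<le> real k"
  shows "pois_mass k l + real J * (pois_mass k l / 2) \<le> 1 - pois_cdf k l"
proof -
  have "pois_cdf (Suc k + j) l \<ge> pois_cdf (Suc k) l + real j * (pois_mass k l / 2)"
    if "j \<le> J" for j
    using that
  proof (induction j)
    case (Suc j)
    have "pois_mass k l / 2 \<le> pois_mass (Suc k + j) l"
      using pois_mass_add_ge[OF k l _ J, of "Suc j"] Suc.prems by simp
    thus ?case
      using Suc by (simp add: pois_cdf_Suc add_divide_distrib distrib_right)
  qed simp
  from this[of J] pois_cdf_le_1[of l "Suc k + J"] l show ?thesis
    by (simp add: pois_cdf_Suc)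
qed

section \<open>Comparison with explicit rates\<close>

lemma one_minus_prob_less_upper:
  assumes k: "k \<ge> 1" and d: "d = sqrt (real k * ln (real k))" and dk: "d < real k"
    and large: "sqrt (real k) \<le> d * (1 - 1 / sqrt (real k))"
  shows "1 - prob_less k (balance_rate k) \<le> d / real k + 1 / sqrt (real k)"
proof -
  define l where "l = real k - d"
  have d0: "0 \<le> d" using k by (simp add: d)
  have l: "0 < l" "l \<le> real k" "real k - l = d" using d0 dk by (auto simp: l_def)
  have "d\<^sup>2 = real k * ln (real k)" using k by (simp add: d)
  \<comment> \<open>The coefficient 1 of \<open>d\<close> is chosen for this: the Chernoff exponent
    is (ln k) / 2 in size, so the tail is at most 1 / sqrt k.\<close>
  hence "d\<^sup>2 / (2 * real k) = ln (sqrt (real k))" using k by (simp add: ln_sqrt)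
  hence "exp (- (d\<^sup>2 / (2 * real k))) = 1 / sqrt (real k)"
    using k by (simp add: exp_minus inverse_eq_divide)
  hence tail: "1 - pois_cdf k l \<le> 1 / sqrt (real k)"
    using pois_tail_le[OF k l(1,2)] by (simp add: l)
  have sk: "real k * (1 / sqrt (real k)) = sqrt (real k)"
    by (simp add: real_div_sqrt)
  have "real k * (1 - pois_cdf k l) \<le> sqrt (real k)"
    using tail sk mult_left_mono[of "1 - pois_cdf k l" "1 / sqrt (real k)" "real k"] by simp
  also have "\<dots> \<le> d * pois_cdf k l"
    using large tail d0 mult_left_mono[of "1 - 1 / sqrt (real k)" "pois_cdf k l" d] by linarith
  also have "\<dots> \<le> shortfall k l"
    using l by (simp add: shortfall_eq pois_mass_nonneg)
  finally have "1 \<le> balance_fun k l"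
    using k by (simp add: balance_fun_def field_simps)
  from one_minus_prob_less_le[OF k l(1) this]
  have "1 - prob_less k (balance_rate k) \<le> shortfall k l / real k" .
  also have "\<dots> = d / real k * pois_cdf k l + pois_mass k l"
    using k by (simp add: shortfall_eq l field_simps)
  also have "\<dots> \<le> d / real k * 1 + 1 / sqrt (real k)"
    using pois_mass_le_tail[of l k] tail l d0
    by (intro add_mono mult_left_mono) (auto simp: pois_cdf_le_1)
  finally show ?thesis by simp
qed

lemma one_minus_prob_less_lower:
  assumes k: "k \<ge> 1" and d: "d = sqrt (real k * ln (real k)) / 4" and dk: "d \<le> real k / 2"
    and J: "2 * real J * (d + real J) \<le> real k"
    and large: "2 * exp 1 * d \<le> real J * sqrt (real k) * real k powr (- 1 / 8)"
  shows "d / real k \<le> 1 - prob_less k (balance_rate k)"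
proof -
  define l where "l = real k - d"
  have d0: "0 \<le> d" using k by (simp add: d)
  have l: "0 < l" "l \<le> real k" "real k / 2 \<le> l" "real k - l = d"
    using d0 dk k by (auto simp: l_def)
  have "d\<^sup>2 = real k * ln (real k) / 16" using k by (simp add: d power_divide)
  \<comment> \<open>With coefficient 1/4 the lower bound for the weight at \<open>k\<close> loses
    only a factor k^(-1/8), so about k^(1/4) such weights outweigh d / k.\<close>
  hence "- (2 * d\<^sup>2 / real k) = - 1 / 8 * ln (real k)" using k by (simp only:) simp
  hence "exp (- (2 * d\<^sup>2 / real k)) = real k powr (- 1 / 8)"
    using k by (simp add: powr_def)
  hence m: "real k powr (- 1 / 8) / (exp 1 * sqrt (real k)) \<le> pois_mass k l"
    using pois_mass_ge[OF k l(3,2)] by (simp add: l)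
  have "d / real k = 2 * exp 1 * d / (2 * exp 1 * (sqrt (real k) * sqrt (real k)))"
    using k by simp
  also have "\<dots> \<le> real J * sqrt (real k) * real k powr (- 1 / 8) /
      (2 * exp 1 * (sqrt (real k) * sqrt (real k)))"
    using large by (intro divide_right_mono) auto
  also have "\<dots> = real J / 2 * (real k powr (- 1 / 8) / (exp 1 * sqrt (real k)))"
    using k by (simp add: field_simps del: real_sqrt_mult_self)
  also have "\<dots> \<le> real J / 2 * pois_mass k l"
    using m by (intro mult_left_mono) auto
  also have "\<dots> = real J * (pois_mass k l / 2)" by simp
  \<comment> \<open>The left side bounds D / k from above because F \<le> 1, whence
    \<open>balance_fun k l \<le> 1\<close>.\<close>
  finally have "d / real k + pois_mass k l \<le> 1 - pois_cdf k l"
    using pois_tail_ge[OF k l(1,2), of J] J unfolding l by linarith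
  moreover have "shortfall k l / real k = d / real k * pois_cdf k l + pois_mass k l"
    using k by (simp add: shortfall_eq l field_simps)
  moreover have "d / real k * pois_cdf k l \<le> d / real k * 1"
    using d0 l by (intro mult_left_mono) (auto simp: pois_cdf_le_1)
  ultimately have "balance_fun k l \<le> 1" by (simp add: balance_fun_def)
  from one_minus_prob_less_ge[OF k l(1) this]
  have "shortfall k l / real k \<le> 1 - prob_less k (balance_rate k)" .
  moreover have "d / real k \<le> shortfall k l / real k"
    using shortfall_ge[of l k] l by (intro divide_right_mono) auto
  ultimately show ?thesis by linarith
qed

lemma one_minus_Theta_balance_rate:
  "one_minus_Theta (\<lambda>k. prob_less k (balance_rate k)) (\<lambda>k. sqrt (ln (real k) / real k))"
proof -
  \<comment> \<open>The exponent 1/4 meets two demands: J (d + J) must be o(k), which allows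
    exponents below 1/2, and J must exceed a multiple of k^(1/8) sqrt (ln k).\<close>
  define J where "J k = nat \<lfloor>real k powr (1/4)\<rfloor>" for k
  have J_le: "real (J k) \<le> real k powr (1/4)" and J_ge: "real k powr (1/4) - 1 \<le> real (J k)" for k
    unfolding J_def by simp_all
  have "eventually (\<lambda>k. sqrt (real k * ln (real k)) < real k) sequentially" by real_asymp
  moreover have "eventually (\<lambda>k. sqrt (real k) \<le>
      sqrt (real k * ln (real k)) * (1 - 1 / sqrt (real k))) sequentially" by real_asymp
  moreover have "eventually (\<lambda>k. sqrt (real k * ln (real k)) / 4 \<le> real k / 2) sequentially"
    by real_asymp
  moreover have "eventually (\<lambda>k. 2 * real k powr (1/4) *
      (sqrt (real k * ln (real k)) / 4 + real k powr (1/4)) \<le> real k) sequentially" by real_asymp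
  moreover have "eventually (\<lambda>k. 2 * exp 1 * (sqrt (real k * ln (real k)) / 4) \<le>
      (real k powr (1/4) - 1) * sqrt (real k) * real k powr (- 1 / 8)) sequentially" by real_asymp
  \<comment> \<open>Since 3 \<ge> e, this gives ln k \<ge> 1, so 1 / sqrt k is absorbed into the
    main term; hence the upper constant 2.\<close>
  moreover have "eventually (\<lambda>k::nat. 3 \<le> k) sequentially" by (rule eventually_ge_at_top)
  ultimately have "eventually (\<lambda>k.
      1 / 4 * sqrt (ln (real k) / real k) \<le> 1 - prob_less k (balance_rate k) \<and>
      1 - prob_less k (balance_rate k) \<le> 2 * sqrt (ln (real k) / real k)) sequentially"
  proof eventually_elim
    case (elim k)
    have k: "k \<ge> 1" using elim by simp
    have sq: "sqrt (real k * ln (real k)) / real k = sqrt (ln (real k) / real k)"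
      using k by (simp add: real_sqrt_mult real_sqrt_divide field_simps)
    have "2 * real (J k) * (sqrt (real k * ln (real k)) / 4 + real (J k)) \<le>
        2 * real k powr (1/4) * (sqrt (real k * ln (real k)) / 4 + real k powr (1/4))"
      using k J_le[of k] by (intro mult_mono add_mono) auto
    hence "2 * real (J k) * (sqrt (real k * ln (real k)) / 4 + real (J k)) \<le> real k"
      using elim(4) by linarith
    moreover have "2 * exp 1 * (sqrt (real k * ln (real k)) / 4) \<le>
        real (J k) * sqrt (real k) * real k powr (- 1 / 8)"
      using elim(5) by (rule order_trans) (intro mult_right_mono J_ge; simp)
    ultimately have "sqrt (real k * ln (real k)) / 4 / real k \<le> 1 - prob_less k (balance_rate k)"
      using elim(3) by (intro one_minus_prob_less_lower[OF k refl]) auto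
    moreover have "1 - prob_less k (balance_rate k) \<le>
        sqrt (real k * ln (real k)) / real k + 1 / sqrt (real k)"
      using elim by (intro one_minus_prob_less_upper[OF k refl]) auto
    moreover have "1 / sqrt (real k) \<le> sqrt (ln (real k) / real k)"
    proof -
      have "exp 1 \<le> real k" using exp_le elim(6) by linarith
      hence "1 \<le> ln (real k)" using k by (simp add: ln_ge_iff)
      thus ?thesis using k by (simp add: real_sqrt_divide divide_right_mono)
    qed
    ultimately show ?case using sq by (simp add: field_simps)
  qed
  thus ?thesis
    unfolding one_minus_Theta_def by (intro exI[of _ "1/4"] exI[of _ 2]) auto
qed

text \<open>The first conjunct makes the \<open>THE\<close> in \<open>balance_rate\<close> well
  defined for positive \<open>k\<close>.\<close>

theorem proposition3:
  "(\<forall>k\<ge>1. \<exists>!l. is_balance_rate k l) \<and>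
   (\<forall>k\<ge>1. prob_less k (balance_rate k) = mean_min k (balance_rate k) / real k) \<and>
   one_minus_Theta (\<lambda>k. prob_less k (balance_rate k)) (\<lambda>k. sqrt (ln (real k) / real k))"
  using ex1_is_balance_rate is_balance_rate_balance_rate one_minus_Theta_balance_rate
  by (auto simp: is_balance_rate_def)

end
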